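(* Let $\ell^{n}=\{M,H\}$ be a Cartan space with $(\alpha,\beta)$-metric whose fundamental function is $H(\alpha,\beta)=\dfrac{\beta^{3}}{\beta-\alpha}$, considered on the region $U\subset T^{*}M\setminus\{0\}$. Then its invariants are $$\rho_{1}=\frac{2\beta^{3}-3\alpha\beta^{2}}{2(\beta-\alpha)^{2}},\quad \rho=\frac{\beta^{3}}{2\alpha(\beta-\alpha)^{2}},\quad \rho_{0}=\frac{\beta^{3}-3\alpha\beta^{2}+3\alpha^{2}\beta}{(\beta-\alpha)^{3}},\quad \rho_{-1}=\frac{\beta^{3}-3\alpha\beta^{2}}{2\alpha(\beta-\alpha)^{3}},\quad \rho_{-2}=\frac{\beta^{3}(3\alpha-\beta)}{2\alpha^{3}(\beta-\alpha)^{3}},$$ $$r_{-1}=\frac{-3\alpha^{3}}{(\beta-\alpha)^{4}},\quad r_{-2}=\frac{3\alpha\beta}{(\beta-\alpha)^{4}},\quad r_{-3}=\frac{4\alpha\beta^{3}-\beta^{4}-9\alpha^{2}\beta^{2}}{2\alpha^{3}(\beta-\alpha)^{4}},\quad r_{-4}=\frac{15\alpha^{2}\beta^{3}+3\beta^{5}-12\alpha\beta^{4}}{2\alpha^{5}(\beta-\alpha)^{4}},$$ and they satisfy the relations $$\alpha^{2}\rho_{-1}+\beta\rho_{0}=\rho_{1},\qquad \alpha^{2}\rho_{-2}+\beta\rho_{-1}=0,$$ $$\alpha^{2}r_{-2}+\beta r_{-1}=0,\qquad \alpha^{2}r_{-3}+\beta r_{-2}=-\rho_{-1},\qquad \alpha^{2}r_{-4}+\beta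 r_{-3}=-2\rho_{-2}.$$
   Context: $M$ is an $n$-dimensional smooth manifold, $(x,y)=(x^i,y_i)$ are the canonical coordinates on $T^{*}M$, and summation over repeated indices is understood. $a^{ij}(x)$ is a (contravariant) Riemannian metric on $M$, $b^{i}(x)$ a vector field on $M$, and $\alpha(x,y)=\sqrt{a^{ij}(x)y_iy_j}$, $\beta(x,y)=b^{i}(x)y_i$. $U$ denotes the region of $T^{*}M\setminus\{0\}$ (zero section removed) where $\beta>0$ and $\alpha<\beta$. A Cartan space $\ell^{n}=\{M,H(x,y)\}$ is given by a fundamental function $H(x,y)$ positively homogeneous of degree $2$ in $y$ whose fundamental tensor $g^{ij}=\frac12\frac{\partial^2 H}{\partial y_i\partial y_j}$ is nondegenerate. It is a Cartan space with $(\alpha,\beta)$-metric if $H(x,y)=H(\alpha(x,y),\beta(x,y))$ is a function of $\alpha$ and $\beta$ only. Subscripts on $H$ denote partial derivatives of $H(\alpha,\beta)$. The invariants of a Cartan space with $(\alpha,\beta)$-metric are $$\rho_{1}=\tfrac12H_{\beta},\quad \rho=\tfrac{1}{2\alpha}H_{\alpha},\quad \rho_{0}=\tfrac12H_{\beta\beta},\quad \rho_{-1}=\tfrac{1}{2\alpha}H_{\alpha\beta},\quad \rho_{-2}=\tfrac{1}{2\alpha^{2}}\left(H_{\alpha\alpha}-\alpha^{-1}H_{\alpha}\right),$$ $$r_{-1}=\tfrac12H_{\beta\beta\beta},\quad r_{-2}=\tfrac{1}{2\alpha}H_{\alpha\beta\beta},\quad r_{-3}=\tfrac{1}{2\alpha^{2}}\left(H_{\alpha\alpha\beta}-\alpha^{-1}H_{\alpha\beta}\right),\quad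 r_{-4}=\tfrac{1}{2\alpha^{3}}\left(H_{\alpha\alpha\alpha}-3\alpha^{-1}H_{\alpha\alpha}+3\alpha^{-2}H_{\alpha}\right).$$ *)

theory Defs
  imports "HOL-Analysis.Analysis"
begin

primrec Ck_on :: "nat \<Rightarrow> ('a::real_normed_vector \<Rightarrow> 'b::real_normed_vector) \<Rightarrow> 'a set \<Rightarrow> bool"
  where
    "Ck_on 0 f S \<longleftrightarrow> continuous_on S f"
  | "Ck_on (Suc k) f S \<longleftrightarrow>
       (\<forall>x\<in>S. f differentiable (at x)) \<and> (\<forall>v. Ck_on k (\<lambda>x. frechet_derivative f (at x) v) S)"

definition smooth_on :: "'a set \<Rightarrow> ('a::real_normed_vector \<Rightarrow> 'b::real_normed_vector) \<Rightarrow> bool"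
  where "smooth_on S f \<longleftrightarrow> open S \<and> (\<forall>k. Ck_on k f S)"

text \<open>The manifold is the whole type \<open>'m\<close>; its dimension is \<open>CARD('n)\<close>. A chart is a pair of
  its domain and a coordinate map, whose values outside the domain are irrelevant.\<close>

type_synonym ('m, 'n) chart = "'m set \<times> ('m \<Rightarrow> real ^ 'n)"

definition chart_inv :: "('m, 'n::finite) chart \<Rightarrow> real ^ 'n \<Rightarrow> 'm"
  where "chart_inv c = inv_into (fst c) (snd c)"

definition smooth_atlas ::
    "('m::{t2_space, second_countable_topology}, 'n::finite) chart set \<Rightarrow> bool"
  where "smooth_atlas A \<longleftrightarrow>
    (\<Union>c\<in>A. fst c) = UNIV \<and>
    (\<forall>c\<in>A. open (fst c) \<and> open (snd c ` fst c) \<and>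
       homeomorphism (fst c) (snd c ` fst c) (snd c) (chart_inv c)) \<and>
    (\<forall>c\<in>A. \<forall>d\<in>A. smooth_on (snd c ` (fst c \<inter> fst d)) (snd d \<circ> chart_inv c))"

text \<open>\<open>jacobian c d p $ j $ i\<close> is \<open>\<partial>x\<^sub>d\<^sup>j / \<partial>x\<^sub>c\<^sup>i\<close> at \<open>p\<close>.\<close>

definition jacobian :: "('m, 'n::finite) chart \<Rightarrow> ('m, 'n) chart \<Rightarrow> 'm \<Rightarrow> real ^ 'n ^ 'n"
  where "jacobian c d p =
    matrix (frechet_derivative (snd d \<circ> chart_inv c) (at (snd c p)))"

text \<open>Tensor fields and covectors are given classically, by their components in each chart,
  subject to the transformation law under a change of chart.\<close>

definition smooth_vector_field ::
    "('m, 'n::finite) chart set \<Rightarrow> (('m, 'n) chart \<Rightarrow> 'm \<Rightarrow> real ^ 'n) \<Rightarrow> bool"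
  where "smooth_vector_field A b \<longleftrightarrow>
    (\<forall>c\<in>A. smooth_on (snd c ` fst c) (b c \<circ> chart_inv c)) \<and>
    (\<forall>c\<in>A. \<forall>d\<in>A. \<forall>p \<in> fst c \<inter> fst d. b d p = jacobian c d p *v b c p)"

definition contravariant_riemannian_metric ::
    "('m, 'n::finite) chart set \<Rightarrow> (('m, 'n) chart \<Rightarrow> 'm \<Rightarrow> real ^ 'n ^ 'n) \<Rightarrow> bool"
  where "contravariant_riemannian_metric A a \<longleftrightarrow>
    (\<forall>c\<in>A. smooth_on (snd c ` fst c) (a c \<circ> chart_inv c)) \<and>
    (\<forall>c\<in>A. \<forall>d\<in>A. \<forall>p \<in> fst c \<inter> fst d.
       a d p = jacobian c d p ** a c p ** transpose (jacobian c d p)) \<and>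
    (\<forall>c\<in>A. \<forall>p \<in> fst c. transpose (a c p) = a c p \<and>
       (\<forall>\<eta>. \<eta> \<noteq> 0 \<longrightarrow> 0 < (\<Sum>i\<in>UNIV. \<Sum>j\<in>UNIV. a c p $ i $ j * \<eta> $ i * \<eta> $ j)))"

text \<open>The components of a covector at \<open>p\<close> are normalised to \<open>0\<close> for charts that do not contain
  \<open>p\<close>, so that equality of covectors is equality of functions.\<close>

type_synonym ('m, 'n) covec = "('m, 'n) chart \<Rightarrow> real ^ 'n"

definition covector_at :: "('m, 'n::finite) chart set \<Rightarrow> 'm \<Rightarrow> ('m, 'n) covec \<Rightarrow> bool"
  where "covector_at A p y \<longleftrightarrow>
    (\<forall>c\<in>A. \<forall>d\<in>A. p \<in> fst c \<inter> fst d \<longrightarrow> y c = transpose (jacobian c d p) *v y d) \<and>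
    (\<forall>c. \<not> (c \<in> A \<and> p \<in> fst c) \<longrightarrow> y c = 0)"

definition slit_cotangent_bundle ::
    "('m, 'n::finite) chart set \<Rightarrow> ('m \<times> ('m, 'n) covec) set"
  where "slit_cotangent_bundle A = {(p, y). covector_at A p y \<and> y \<noteq> (\<lambda>_. 0)}"

definition fibre_scale :: "real \<Rightarrow> 'm \<times> ('m, 'n::finite) covec \<Rightarrow> 'm \<times> ('m, 'n) covec"
  where "fibre_scale t P = (fst P, \<lambda>c. t *\<^sub>R snd P c)"

text \<open>The point of the cotangent bundle with canonical coordinates \<open>(x, \<eta>)\<close> in the chart \<open>c\<close>.\<close>

definition cotangent_point ::
    "('m, 'n::finite) chart set \<Rightarrow> ('m, 'n) chart \<Rightarrow> (real ^ 'n) \<times> (real ^ 'n)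
      \<Rightarrow> 'm \<times> ('m, 'n) covec"
  where "cotangent_point A c z =
    (let p = chart_inv c (fst z) in
      (p, \<lambda>d. if d \<in> A \<and> p \<in> fst d then transpose (jacobian d c p) *v snd z else 0))"

definition partial_deriv :: "'n::finite \<Rightarrow> (real ^ 'n \<Rightarrow> real) \<Rightarrow> real ^ 'n \<Rightarrow> real"
  where "partial_deriv i f \<eta> = frechet_derivative f (at \<eta>) (axis i 1)"

definition fundamental_tensor ::
    "('m, 'n::finite) chart set \<Rightarrow> ('m \<times> ('m, 'n) covec \<Rightarrow> real) \<Rightarrow> ('m, 'n) chart
      \<Rightarrow> 'm \<times> ('m, 'n) covec \<Rightarrow> real ^ 'n ^ 'n"
  where "fundamental_tensor A F c P =
    (\<chi> i j. 1 / 2 *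
      partial_deriv i (partial_deriv j (\<lambda>\<eta>. F (cotangent_point A c (snd c (fst P), \<eta>))))
        (snd P c))"

text \<open>\<open>D\<close> is the region of the slit cotangent bundle on which the fundamental function \<open>F\<close> is
  considered. The smoothness condition contains that \<open>D\<close> is open.\<close>

definition cartan_space ::
    "('m, 'n::finite) chart set \<Rightarrow> ('m \<times> ('m, 'n) covec) set
      \<Rightarrow> ('m \<times> ('m, 'n) covec \<Rightarrow> real) \<Rightarrow> bool"
  where "cartan_space A D F \<longleftrightarrow>
    D \<subseteq> slit_cotangent_bundle A \<and>
    (\<forall>c\<in>A. smooth_on {z. fst z \<in> snd c ` fst c \<and> cotangent_point A c z \<in> D}
              (\<lambda>z. F (cotangent_point A c z))) \<and>
    (\<forall>P\<in>D. \<forall>t>0. fibre_scale t P \<in> D \<and> F (fibre_scale t P) = t\<^sup>2 * F P) \<and>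
    (\<forall>c\<in>A. \<forall>P\<in>D. fst P \<in> fst c \<longrightarrow> invertible (fundamental_tensor A F c P))"

text \<open>\<open>\<alpha>\<close> and \<open>\<beta>\<close> are computed in some chart; the lemmas below show that the choice is
  irrelevant.\<close>

definition chart_around :: "('m, 'n::finite) chart set \<Rightarrow> 'm \<Rightarrow> ('m, 'n) chart"
  where "chart_around A p = (SOME c. c \<in> A \<and> p \<in> fst c)"

definition alpha ::
    "('m, 'n::finite) chart set \<Rightarrow> (('m, 'n) chart \<Rightarrow> 'm \<Rightarrow> real ^ 'n ^ 'n)
      \<Rightarrow> 'm \<times> ('m, 'n) covec \<Rightarrow> real"
  where "alpha A a P =
    (let p = fst P; c = chart_around A p; \<eta> = snd P c in
      sqrt (\<Sum>i\<in>UNIV. \<Sum>j\<in>UNIV. a c p $ i $ j * \<eta> $ i * \<eta> $ j))"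

definition beta ::
    "('m, 'n::finite) chart set \<Rightarrow> (('m, 'n) chart \<Rightarrow> 'm \<Rightarrow> real ^ 'n)
      \<Rightarrow> 'm \<times> ('m, 'n) covec \<Rightarrow> real"
  where "beta A b P =
    (let p = fst P; c = chart_around A p; \<eta> = snd P c in \<Sum>i\<in>UNIV. b c p $ i * \<eta> $ i)"

lemma chart_around:
  assumes "c \<in> A" "p \<in> fst c"
  shows "chart_around A p \<in> A" "p \<in> fst (chart_around A p)"
  using someI[of "\<lambda>c. c \<in> A \<and> p \<in> fst c" c] assms by (auto simp: chart_around_def)

lemma quadratic_form_eq_inner:
  "(\<Sum>i\<in>UNIV. \<Sum>j\<in>UNIV. M $ i $ j * \<eta> $ i * \<eta> $ j) = \<eta> \<bullet> (M *v \<eta>)"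
  for M :: "real ^ 'n ^ 'n::finite"
  by (simp add: inner_vec_def matrix_vector_mult_def sum_distrib_left mult_ac)

lemma alpha_eq:
  fixes a :: "('m, 'n::finite) chart \<Rightarrow> 'm \<Rightarrow> real ^ 'n ^ 'n"
  assumes a: "contravariant_riemannian_metric A a" and y: "covector_at A p y"
    and d: "d \<in> A" "p \<in> fst d"
  shows "alpha A a (p, y) = sqrt (\<Sum>i\<in>UNIV. \<Sum>j\<in>UNIV. a d p $ i $ j * y d $ i * y d $ j)"
proof -
  define c where "c = chart_around A p"
  have c: "c \<in> A" "p \<in> fst c"
    using chart_around[OF d] by (auto simp: c_def)
  define J where "J = jacobian c d p"
  have yc: "y c = transpose J *v y d"
    using y c d unfolding covector_at_def J_def by blast
  have ad: "a d p = J ** a c p ** transpose J"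
    using a c d unfolding contravariant_riemannian_metric_def J_def by blast
  have "y c \<bullet> (a c p *v y c) = y d \<bullet> (a d p *v y d)"
    by (simp add: yc ad dot_lmul_matrix flip: matrix_vector_mul_assoc)
  then show ?thesis
    by (simp add: alpha_def Let_def quadratic_form_eq_inner flip: c_def)
qed

lemma beta_eq:
  fixes b :: "('m, 'n::finite) chart \<Rightarrow> 'm \<Rightarrow> real ^ 'n"
  assumes b: "smooth_vector_field A b" and y: "covector_at A p y"
    and d: "d \<in> A" "p \<in> fst d"
  shows "beta A b (p, y) = (\<Sum>i\<in>UNIV. b d p $ i * y d $ i)"
proof -
  define c where "c = chart_around A p"
  have c: "c \<in> A" "p \<in> fst c"
    using chart_around[OF d] by (auto simp: c_def)
  define J where "J = jacobian c d p"
  have yc: "y c = transpose J *v y d"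
    using y c d unfolding covector_at_def J_def by blast
  have bd: "b d p = J *v b c p"
    using b c d unfolding smooth_vector_field_def J_def by blast
  have "y c \<bullet> b c p = y d \<bullet> b d p"
    by (simp add: yc bd dot_lmul_matrix)
  then show ?thesis
    by (simp add: beta_def Let_def inner_vec_def mult.commute flip: c_def)
qed

definition alpha_beta_region ::
    "('m, 'n::finite) chart set \<Rightarrow> (('m, 'n) chart \<Rightarrow> 'm \<Rightarrow> real ^ 'n ^ 'n)
      \<Rightarrow> (('m, 'n) chart \<Rightarrow> 'm \<Rightarrow> real ^ 'n) \<Rightarrow> ('m \<times> ('m, 'n) covec) set"
  where "alpha_beta_region A a b =
    {P \<in> slit_cotangent_bundle A. 0 < beta A b P \<and> alpha A a P < beta A b P}"

definition alpha_beta_cartan_space ::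
    "('m, 'n::finite) chart set \<Rightarrow> (('m, 'n) chart \<Rightarrow> 'm \<Rightarrow> real ^ 'n ^ 'n)
      \<Rightarrow> (('m, 'n) chart \<Rightarrow> 'm \<Rightarrow> real ^ 'n) \<Rightarrow> ('m \<times> ('m, 'n) covec) set
      \<Rightarrow> ('m \<times> ('m, 'n) covec \<Rightarrow> real) \<Rightarrow> (real \<Rightarrow> real \<Rightarrow> real) \<Rightarrow> bool"
  where "alpha_beta_cartan_space A a b D F H \<longleftrightarrow>
    contravariant_riemannian_metric A a \<and> smooth_vector_field A b \<and>
    cartan_space A D F \<and> (\<forall>P\<in>D. F P = H (alpha A a P) (beta A b P))"

definition d_alpha :: "(real \<Rightarrow> real \<Rightarrow> real) \<Rightarrow> real \<Rightarrow> real \<Rightarrow> real"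
  where "d_alpha H s t = deriv (\<lambda>u. H u t) s"

definition d_beta :: "(real \<Rightarrow> real \<Rightarrow> real) \<Rightarrow> real \<Rightarrow> real \<Rightarrow> real"
  where "d_beta H s t = deriv (\<lambda>u. H s u) t"

text \<open>In the names of the invariants, \<open>m\<close> stands for the minus sign of the subscript.\<close>

definition rho_1 :: "(real \<Rightarrow> real \<Rightarrow> real) \<Rightarrow> real \<Rightarrow> real \<Rightarrow> real"
  where "rho_1 H s t = 1 / 2 * d_beta H s t"

definition rho :: "(real \<Rightarrow> real \<Rightarrow> real) \<Rightarrow> real \<Rightarrow> real \<Rightarrow> real"
  where "rho H s t = 1 / (2 * s) * d_alpha H s t"

definition rho_0 :: "(real \<Rightarrow> real \<Rightarrow> real) \<Rightarrow> real \<Rightarrow> real \<Rightarrow> real"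
  where "rho_0 H s t = 1 / 2 * d_beta (d_beta H) s t"

definition rho_m1 :: "(real \<Rightarrow> real \<Rightarrow> real) \<Rightarrow> real \<Rightarrow> real \<Rightarrow> real"
  where "rho_m1 H s t = 1 / (2 * s) * d_beta (d_alpha H) s t"

definition rho_m2 :: "(real \<Rightarrow> real \<Rightarrow> real) \<Rightarrow> real \<Rightarrow> real \<Rightarrow> real"
  where "rho_m2 H s t =
    1 / (2 * s\<^sup>2) * (d_alpha (d_alpha H) s t - 1 / s * d_alpha H s t)"

definition r_m1 :: "(real \<Rightarrow> real \<Rightarrow> real) \<Rightarrow> real \<Rightarrow> real \<Rightarrow> real"
  where "r_m1 H s t = 1 / 2 * d_beta (d_beta (d_beta H)) s t"

definition r_m2 :: "(real \<Rightarrow> real \<Rightarrow> real) \<Rightarrow> real \<Rightarrow> real \<Rightarrow> real"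
  where "r_m2 H s t = 1 / (2 * s) * d_beta (d_beta (d_alpha H)) s t"

definition r_m3 :: "(real \<Rightarrow> real \<Rightarrow> real) \<Rightarrow> real \<Rightarrow> real \<Rightarrow> real"
  where "r_m3 H s t =
    1 / (2 * s\<^sup>2) * (d_beta (d_alpha (d_alpha H)) s t - 1 / s * d_beta (d_alpha H) s t)"

definition r_m4 :: "(real \<Rightarrow> real \<Rightarrow> real) \<Rightarrow> real \<Rightarrow> real \<Rightarrow> real"
  where "r_m4 H s t =
    1 / (2 * s ^ 3) * (d_alpha (d_alpha (d_alpha H)) s t
      - 3 / s * d_alpha (d_alpha H) s t + 3 / s\<^sup>2 * d_alpha H s t)"

end

theory Submission
  imports Defs
begin

text \<open>Every iterated partial derivative of \<open>H = \<beta>\<^sup>3 / (\<beta> - \<alpha>)\<close> is a polynomial over a power of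
  \<open>\<beta> - \<alpha>\<close>, and a further derivative raises that power by one. The closed forms hold on the open
  cone \<open>0 < \<alpha> < \<beta>\<close>; the covector being nonzero is what gives \<open>\<alpha> > 0\<close> there.\<close>

lemma alpha_pos:
  fixes a :: "('m, 'n::finite) chart \<Rightarrow> 'm \<Rightarrow> real ^ 'n ^ 'n"
  assumes a: "contravariant_riemannian_metric A a" and P: "P \<in> slit_cotangent_bundle A"
  shows "0 < alpha A a P"
proof -
  obtain p y where Py: "P = (p, y)" and y: "covector_at A p y" and nz: "y \<noteq> (\<lambda>_. 0)"
    using P by (auto simp: slit_cotangent_bundle_def)
  obtain d where yd: "y d \<noteq> 0"
    using nz by blast
  \<comment> \<open>Covector components are normalised to 0 on every chart that is not an atlas
    chart around \<open>p\<close>, so a nonzero component can only sit on a chart where positive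
    definiteness applies.\<close>
  then have d: "d \<in> A" "p \<in> fst d"
    using y unfolding covector_at_def by blast+
  then have "0 < (\<Sum>i\<in>UNIV. \<Sum>j\<in>UNIV. a d p $ i $ j * y d $ i * y d $ j)"
    using a yd unfolding contravariant_riemannian_metric_def by blast
  then show ?thesis
    by (simp add: Py alpha_eq[OF a y d])
qed

text \<open>The plain quotient rule has denominator q^(2n). Cancelling down to q^(n+1) keeps
  iterated derivatives in the form numerator over a low power, ready to be differentiated
  again.\<close>

lemma DERIV_divide_power:
  assumes "(p has_real_derivative p') (at x)" "(q has_real_derivative q') (at x)" "q x \<noteq> 0"
  shows "((\<lambda>u. p u / q u ^ n) has_real_derivative
    (p' * q x - real n * q' * p x) / q x ^ Suc n) (at x)"
\<comment> \<open>For \<open>n = Suc m\<close> the factor \<open>q x ^ m\<close> cancels; for n = 0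
  the value is \<open>p' * q x / q x\<close>, which is \<open>p'\<close> since
  \<open>q x \<noteq> 0\<close>.\<close>
proof (cases n)
  case (Suc m)
  have "((\<lambda>u. p u / q u ^ n) has_real_derivative
      (p' * q x ^ n - p x * (real n * q x ^ (n - 1) * q')) / (q x ^ n * q x ^ n)) (at x)"
    using assms by (auto intro!: derivative_eq_intros)
  also have "(p' * q x ^ n - p x * (real n * q x ^ (n - 1) * q')) / (q x ^ n * q x ^ n)
      = (p' * q x - real n * q' * p x) / q x ^ Suc n"
    using assms(3) by (simp add: Suc field_simps)
  finally show ?thesis .
qed (use assms in simp)

text \<open>Differentiation is local, so the formula for \<open>G\<close> is required only on the
  open interval (0, t) around s. The plus sign comes from t - u having slope -1. Keeping
  \<open>q\<close> and \<open>m\<close> as variables tied by equations lets any simplified closed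
  form be matched, leaving a polynomial identity.\<close>

lemma d_alpha_quotient:
  assumes "(p has_real_derivative p') (at s)" "0 < s" "s < t"
    and G: "\<And>u. 0 < u \<Longrightarrow> u < t \<Longrightarrow> G u t = p u / (t - u) ^ n"
    and "p' * (t - s) + real n * p s = q" "m = Suc n"
  shows "d_alpha G s t = q / (t - s) ^ m"
proof -
  have "((\<lambda>u. p u / (t - u) ^ n) has_real_derivative q / (t - s) ^ m) (at s)"
    using assms by (auto intro!: derivative_eq_intros DERIV_cong[OF DERIV_divide_power])
  then have "((\<lambda>u. G u t) has_real_derivative q / (t - s) ^ m) (at s)"
    by (rule has_field_derivative_transform_within_open[of _ _ _ "{0<..<t}"]) (use assms in auto)
  then show ?thesis
    unfolding d_alpha_def by (rule DERIV_imp_deriv)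
qed

text \<open>The counterpart in the second argument: u - s has slope +1, hence the minus sign, and
  the cone is unbounded in this direction, so the neighbourhood is the ray above s.\<close>

lemma d_beta_quotient:
  assumes "(p has_real_derivative p') (at t)" "s < t"
    and G: "\<And>u. s < u \<Longrightarrow> G s u = p u / (u - s) ^ n"
    and "p' * (t - s) - real n * p t = q" "m = Suc n"
  shows "d_beta G s t = q / (t - s) ^ m"
proof -
  have "((\<lambda>u. p u / (u - s) ^ n) has_real_derivative q / (t - s) ^ m) (at t)"
    using assms by (auto intro!: derivative_eq_intros DERIV_cong[OF DERIV_divide_power])
  then have "((\<lambda>u. G s u) has_real_derivative q / (t - s) ^ m) (at t)"
    by (rule has_field_derivative_transform_within_open[of _ _ _ "{s<..}"]) (use assms in auto)
  then show ?thesis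
    unfolding d_beta_def by (rule DERIV_imp_deriv)
qed

context
  fixes H :: "real \<Rightarrow> real \<Rightarrow> real"
  assumes H: "\<forall>s t. 0 < s \<longrightarrow> s < t \<longrightarrow> H s t = t ^ 3 / (t - s)"
begin

text \<open>The numerator is constant in \<alpha>, so successive \<alpha>-derivatives just multiply
  it by the current exponents 1, 2, 3. Each closed form covers the whole cone because the next
  derivative uses it on a neighbourhood.\<close>

lemma d_alpha_H:
  assumes "0 < s" "s < t"
  shows "d_alpha H s t = t ^ 3 / (t - s)\<^sup>2"
proof (rule d_alpha_quotient)
  show "((\<lambda>u. t ^ 3) has_real_derivative 0) (at s)"
    by (auto intro!: derivative_eq_intros)
qed (use assms in \<open>simp_all add: H algebra_simps eval_nat_numeral\<close>)

lemma d_alpha2_H: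
  assumes "0 < s" "s < t"
  shows "d_alpha (d_alpha H) s t = (2 * t ^ 3) / (t - s) ^ 3"
proof (rule d_alpha_quotient)
  show "((\<lambda>u. t ^ 3) has_real_derivative 0) (at s)"
    by (auto intro!: derivative_eq_intros)
qed (use assms in \<open>simp_all add: d_alpha_H algebra_simps eval_nat_numeral\<close>)

lemma d_alpha3_H:
  assumes "0 < s" "s < t"
  shows "d_alpha (d_alpha (d_alpha H)) s t = (6 * t ^ 3) / (t - s) ^ 4"
proof (rule d_alpha_quotient)
  show "((\<lambda>u. 2 * t ^ 3) has_real_derivative 0) (at s)"
    by (auto intro!: derivative_eq_intros)
qed (use assms in \<open>simp_all add: d_alpha2_H algebra_simps eval_nat_numeral\<close>)

lemma d_beta_H:
  assumes "0 < s" "s < t"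
  shows "d_beta H s t = (2 * t ^ 3 - 3 * s * t\<^sup>2) / (t - s)\<^sup>2"
proof (rule d_beta_quotient)
  show "((\<lambda>u. u ^ 3) has_real_derivative 3 * t\<^sup>2) (at t)"
    by (auto intro!: derivative_eq_intros)
qed (use assms in \<open>simp_all add: H algebra_simps eval_nat_numeral\<close>)

lemma d_beta2_H:
  assumes "0 < s" "s < t"
  shows "d_beta (d_beta H) s t = (2 * (t ^ 3 - 3 * s * t\<^sup>2 + 3 * s\<^sup>2 * t)) / (t - s) ^ 3"
proof (rule d_beta_quotient)
  show "((\<lambda>u. 2 * u ^ 3 - 3 * s * u\<^sup>2) has_real_derivative 6 * t\<^sup>2 - 6 * s * t) (at t)"
    by (auto intro!: derivative_eq_intros)
qed (use assms in \<open>simp_all add: d_beta_H algebra_simps eval_nat_numeral\<close>)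

text \<open>The numerator loses \<beta> because H = \<beta>^2 + \<alpha>\<beta> + \<alpha>^2 +
  \<alpha>^3/(\<beta> - \<alpha>): the quadratic part dies after three \<beta>-derivatives.\<close>

lemma d_beta3_H:
  assumes "0 < s" "s < t"
  shows "d_beta (d_beta (d_beta H)) s t = (- 6 * s ^ 3) / (t - s) ^ 4"
proof (rule d_beta_quotient)
  show "((\<lambda>u. 2 * (u ^ 3 - 3 * s * u\<^sup>2 + 3 * s\<^sup>2 * u)) has_real_derivative 6 * t\<^sup>2 - 12 * s * t + 6 * s\<^sup>2) (at t)"
    by (auto intro!: derivative_eq_intros)
qed (use assms in \<open>simp_all add: d_beta2_H algebra_simps eval_nat_numeral\<close>)

text \<open>Mixed derivatives take \<alpha> innermost, the order used in \<open>rho_m1\<close>,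
  \<open>r_m2\<close> and \<open>r_m3\<close>, so they start from the closed forms of the pure
  \<alpha>-derivatives.\<close>

lemma d_beta_d_alpha_H:
  assumes "0 < s" "s < t"
  shows "d_beta (d_alpha H) s t = (t ^ 3 - 3 * s * t\<^sup>2) / (t - s) ^ 3"
proof (rule d_beta_quotient)
  show "((\<lambda>u. u ^ 3) has_real_derivative 3 * t\<^sup>2) (at t)"
    by (auto intro!: derivative_eq_intros)
qed (use assms in \<open>simp_all add: d_alpha_H algebra_simps eval_nat_numeral\<close>)

lemma d_beta2_d_alpha_H:
  assumes "0 < s" "s < t"
  shows "d_beta (d_beta (d_alpha H)) s t = (6 * s\<^sup>2 * t) / (t - s) ^ 4"
proof (rule d_beta_quotient)
  show "((\<lambda>u. u ^ 3 - 3 * s * u\<^sup>2) has_real_derivative 3 * t\<^sup>2 - 6 * s * t) (at t)"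
    by (auto intro!: derivative_eq_intros)
qed (use assms in \<open>simp_all add: d_beta_d_alpha_H algebra_simps eval_nat_numeral\<close>)

lemma d_beta_d_alpha2_H:
  assumes "0 < s" "s < t"
  shows "d_beta (d_alpha (d_alpha H)) s t = (- 6 * s * t\<^sup>2) / (t - s) ^ 4"
proof (rule d_beta_quotient)
  show "((\<lambda>u. 2 * u ^ 3) has_real_derivative 6 * t\<^sup>2) (at t)"
    by (auto intro!: derivative_eq_intros)
qed (use assms in \<open>simp_all add: d_alpha2_H algebra_simps eval_nat_numeral\<close>)

end

theorem theorem5p3:
  fixes A :: "('m::{t2_space, second_countable_topology}, 'n::finite) chart set"
    and a :: "('m, 'n) chart \<Rightarrow> 'm \<Rightarrow> real ^ 'n ^ 'n"
    and b :: "('m, 'n) chart \<Rightarrow> 'm \<Rightarrow> real ^ 'n"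
    and F :: "'m \<times> ('m, 'n) covec \<Rightarrow> real"
    and H :: "real \<Rightarrow> real \<Rightarrow> real"
    and P :: "'m \<times> ('m, 'n) covec"
    and \<alpha> \<beta> :: real
  assumes "smooth_atlas A"
    and "alpha_beta_cartan_space A a b (alpha_beta_region A a b) F H"
    and "\<And>s t. 0 < s \<Longrightarrow> s < t \<Longrightarrow> H s t = t ^ 3 / (t - s)"
    and "P \<in> alpha_beta_region A a b"
    and "\<alpha> = alpha A a P" and "\<beta> = beta A b P"
  shows
    "rho_1 H \<alpha> \<beta> = (2 * \<beta> ^ 3 - 3 * \<alpha> * \<beta>\<^sup>2) / (2 * (\<beta> - \<alpha>)\<^sup>2) \<and>
     rho H \<alpha> \<beta> = \<beta> ^ 3 / (2 * \<alpha> * (\<beta> - \<alpha>)\<^sup>2) \<and>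
     rho_0 H \<alpha> \<beta> = (\<beta> ^ 3 - 3 * \<alpha> * \<beta>\<^sup>2 + 3 * \<alpha>\<^sup>2 * \<beta>) / (\<beta> - \<alpha>) ^ 3 \<and>
     rho_m1 H \<alpha> \<beta> = (\<beta> ^ 3 - 3 * \<alpha> * \<beta>\<^sup>2) / (2 * \<alpha> * (\<beta> - \<alpha>) ^ 3) \<and>
     rho_m2 H \<alpha> \<beta> = \<beta> ^ 3 * (3 * \<alpha> - \<beta>) / (2 * \<alpha> ^ 3 * (\<beta> - \<alpha>) ^ 3) \<and>
     r_m1 H \<alpha> \<beta> = - 3 * \<alpha> ^ 3 / (\<beta> - \<alpha>) ^ 4 \<and>
     r_m2 H \<alpha> \<beta> = 3 * \<alpha> * \<beta> / (\<beta> - \<alpha>) ^ 4 \<and>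
     r_m3 H \<alpha> \<beta> = (4 * \<alpha> * \<beta> ^ 3 - \<beta> ^ 4 - 9 * \<alpha>\<^sup>2 * \<beta>\<^sup>2) / (2 * \<alpha> ^ 3 * (\<beta> - \<alpha>) ^ 4) \<and>
     r_m4 H \<alpha> \<beta> = (15 * \<alpha>\<^sup>2 * \<beta> ^ 3 + 3 * \<beta> ^ 5 - 12 * \<alpha> * \<beta> ^ 4) / (2 * \<alpha> ^ 5 * (\<beta> - \<alpha>) ^ 4) \<and>
     \<alpha>\<^sup>2 * rho_m1 H \<alpha> \<beta> + \<beta> * rho_0 H \<alpha> \<beta> = rho_1 H \<alpha> \<beta> \<and>
     \<alpha>\<^sup>2 * rho_m2 H \<alpha> \<beta> + \<beta> * rho_m1 H \<alpha> \<beta> = 0 \<and>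
     \<alpha>\<^sup>2 * r_m2 H \<alpha> \<beta> + \<beta> * r_m1 H \<alpha> \<beta> = 0 \<and>
     \<alpha>\<^sup>2 * r_m3 H \<alpha> \<beta> + \<beta> * r_m2 H \<alpha> \<beta> = - rho_m1 H \<alpha> \<beta> \<and>
     \<alpha>\<^sup>2 * r_m4 H \<alpha> \<beta> + \<beta> * r_m3 H \<alpha> \<beta> = - 2 * rho_m2 H \<alpha> \<beta>"
proof -
  have pos: "0 < \<alpha>" "\<alpha> < \<beta>"
    using assms(2,4-6) alpha_pos[of A a P]
    unfolding alpha_beta_cartan_space_def alpha_beta_region_def by blast+
  \<comment> \<open>With \<beta> = \<alpha> + \<delta> all denominators are powers of the nonzero
    quantities \<alpha> and \<delta>, and clearing them turns every claim into a polynomial identity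
    in \<alpha> and \<delta>.\<close>
  define \<delta> where "\<delta> = \<beta> - \<alpha>"
  have nz: "\<alpha> \<noteq> 0" "\<delta> \<noteq> 0" and \<beta>: "\<beta> = \<alpha> + \<delta>"
    using pos by (auto simp: \<delta>_def)
  have H: "\<forall>s t. 0 < s \<longrightarrow> s < t \<longrightarrow> H s t = t ^ 3 / (t - s)"
    using assms(3) by blast
  note H_derivs = d_alpha_H[OF H pos] d_alpha2_H[OF H pos] d_alpha3_H[OF H pos]
    d_beta_H[OF H pos] d_beta2_H[OF H pos] d_beta3_H[OF H pos]
    d_beta_d_alpha_H[OF H pos] d_beta2_d_alpha_H[OF H pos] d_beta_d_alpha2_H[OF H pos]
  have rho_1: "rho_1 H \<alpha> \<beta> = (2 * \<beta> ^ 3 - 3 * \<alpha> * \<beta>\<^sup>2) / (2 * (\<beta> - \<alpha>)\<^sup>2)"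
    unfolding rho_1_def H_derivs \<delta>_def[symmetric] using nz
    by (simp add: \<beta> field_simps eval_nat_numeral)
  have rho: "rho H \<alpha> \<beta> = \<beta> ^ 3 / (2 * \<alpha> * (\<beta> - \<alpha>)\<^sup>2)"
    unfolding rho_def H_derivs \<delta>_def[symmetric] using nz
    by (simp add: \<beta> field_simps eval_nat_numeral)
  have rho_0: "rho_0 H \<alpha> \<beta> = (\<beta> ^ 3 - 3 * \<alpha> * \<beta>\<^sup>2 + 3 * \<alpha>\<^sup>2 * \<beta>) / (\<beta> - \<alpha>) ^ 3"
    unfolding rho_0_def H_derivs \<delta>_def[symmetric] using nz
    by (simp add: \<beta> field_simps eval_nat_numeral)
  have rho_m1: "rho_m1 H \<alpha> \<beta> = (\<beta> ^ 3 - 3 * \<alpha> * \<beta>\<^sup>2) / (2 * \<alpha> * (\<beta> - \<alpha>) ^ 3)"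
    unfolding rho_m1_def H_derivs \<delta>_def[symmetric] using nz
    by (simp add: \<beta> field_simps eval_nat_numeral)
  have rho_m2: "rho_m2 H \<alpha> \<beta> = \<beta> ^ 3 * (3 * \<alpha> - \<beta>) / (2 * \<alpha> ^ 3 * (\<beta> - \<alpha>) ^ 3)"
    unfolding rho_m2_def H_derivs \<delta>_def[symmetric] using nz
    by (simp add: \<beta> field_simps eval_nat_numeral)
  have r_m1: "r_m1 H \<alpha> \<beta> = - 3 * \<alpha> ^ 3 / (\<beta> - \<alpha>) ^ 4"
    unfolding r_m1_def H_derivs \<delta>_def[symmetric] using nz
    by (simp add: \<beta> field_simps eval_nat_numeral)
  have r_m2: "r_m2 H \<alpha> \<beta> = 3 * \<alpha> * \<beta> / (\<beta> - \<alpha>) ^ 4"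
    unfolding r_m2_def H_derivs \<delta>_def[symmetric] using nz
    by (simp add: \<beta> field_simps eval_nat_numeral)
  \<comment> \<open>Here the two terms have denominators \<delta>^4 and \<alpha>\<delta>^3; bringing
    them to a common one produces the factor \<alpha>^3 and the quartic numerator.\<close>
  have r_m3: "r_m3 H \<alpha> \<beta> = (4 * \<alpha> * \<beta> ^ 3 - \<beta> ^ 4 - 9 * \<alpha>\<^sup>2 * \<beta>\<^sup>2) / (2 * \<alpha> ^ 3 * (\<beta> - \<alpha>) ^ 4)"
    unfolding r_m3_def H_derivs \<delta>_def[symmetric] using nz
    by (simp add: \<beta> field_simps eval_nat_numeral)
  have r_m4: "r_m4 H \<alpha> \<beta> = (15 * \<alpha>\<^sup>2 * \<beta> ^ 3 + 3 * \<beta> ^ 5 - 12 * \<alpha> * \<beta> ^ 4) / (2 * \<alpha> ^ 5 * (\<beta> - \<alpha>) ^ 4)"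
    unfolding r_m4_def H_derivs \<delta>_def[symmetric] using nz
    by (simp add: \<beta> field_simps eval_nat_numeral)
  note invariants = rho_1 rho rho_0 rho_m1 rho_m2 r_m1 r_m2 r_m3 r_m4
  \<comment> \<open>Behind the five relations is Euler's identity: H has degree 2 in (\<alpha>,
    \<beta>), its first derivatives degree 1, its second derivatives degree 0. The first three
    express it for H_\<beta>, H_\<alpha> and H_\<beta>\<beta>. In the last two, the lower-order
    terms subtracted in \<open>r_m3\<close> and \<open>r_m4\<close> leave the right-hand sides. All
    are checked on the closed forms.\<close>
  have "\<alpha>\<^sup>2 * rho_m1 H \<alpha> \<beta> + \<beta> * rho_0 H \<alpha> \<beta> = rho_1 H \<alpha> \<beta>"
    unfolding invariants \<delta>_def[symmetric] using nz
    by (simp add: \<beta> field_simps eval_nat_numeral)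
  moreover have "\<alpha>\<^sup>2 * rho_m2 H \<alpha> \<beta> + \<beta> * rho_m1 H \<alpha> \<beta> = 0"
    unfolding invariants \<delta>_def[symmetric] using nz
    by (simp add: \<beta> field_simps eval_nat_numeral)
  moreover have "\<alpha>\<^sup>2 * r_m2 H \<alpha> \<beta> + \<beta> * r_m1 H \<alpha> \<beta> = 0"
    unfolding invariants \<delta>_def[symmetric] using nz
    by (simp add: \<beta> field_simps eval_nat_numeral)
  moreover have "\<alpha>\<^sup>2 * r_m3 H \<alpha> \<beta> + \<beta> * r_m2 H \<alpha> \<beta> = - rho_m1 H \<alpha> \<beta>"
    unfolding invariants \<delta>_def[symmetric] using nz
    by (simp add: \<beta> field_simps eval_nat_numeral)
  moreover have "\<alpha>\<^sup>2 * r_m4 H \<alpha> \<beta> + \<beta> * r_m3 H \<alpha> \<beta> = - 2 * rho_m2 H \<alpha> \<beta>"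
    unfolding invariants \<delta>_def[symmetric] using nz
    by (simp add: \<beta> field_simps eval_nat_numeral)
  ultimately show ?thesis
    using invariants by blast
qed

end
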